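(* Let $X$ be a nonempty locally compact Hausdorff space and let $(Y,d)$ be a metric space with at least two points. The space $MU(X,Y)$ is locally $\sigma$-compact if and only if one of the following conditions holds: (i) $MU(X,Y)$ is locally compact; (ii) $Y$ is locally $\sigma$-compact and $X$ is finite.
   Context: A map (multifunction) $F\colon X\to Y$ assigns to each $x\in X$ a subset $F(x)\subseteq Y$; for $A\subseteq X$ put $F(A)=\bigcup_{x\in A}F(x)$. Maps are identified with their graphs $\{(x,y): y\in F(x)\}$. $F$ is upper semicontinuous if for every $x\in X$ and every open $V\supseteq F(x)$ there is an open $U\ni x$ with $F(U)\subseteq V$. $F$ is usco if it is upper semicontinuous and every $F(x)$ is a nonempty compact set. $F$ is minimal usco if it is usco and its graph does not properly contain the graph of any other usco map from $X$ to $Y$. $MU(X,Y)$ is the set of all minimal usco maps from $X$ to $Y$. Let $K(Y)$ be the set of nonempty compact subsets of $Y$, and $H_d$ the Hausdorff metric on $K(Y)$. On $K(Y)^X$ the topology $\tau_{uc}$ of uniform convergence on compact sets is induced by the uniformity $\mathcal U_{uc}$ with base consisting of the sets $W[K,\varepsilon]=\{(F,G): H_d(F(x),G(x))<\varepsilon \text{ for every } x\in K\}$, where $K\subseteq X$ is compact and $\varepsilon>0$. $MU(X,Y)\subseteq K(Y)^X$ carries the subspace topology of $\tau_{uc}$. A space is locally $\sigma$-compact if each of its points has a neighborhood that is a $\sigma$-compact subspace. *)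

theory Defs
  imports "HOL-Analysis.Analysis"
begin

text \<open>A multifunction from \<open>X\<close> to \<open>Y\<close> is a function \<open>'a \<Rightarrow> 'b set\<close>; the spaces \<open>X\<close> and \<open>Y\<close> are
  the types \<open>'a\<close> and \<open>'b\<close>. The spaces \<open>K(Y)\<^sup>X\<close> and \<open>MU(X,Y)\<close> are proper subsets of a function type
  and are therefore treated as abstract topologies.\<close>

definition mf_graph :: "('a \<Rightarrow> 'b set) \<Rightarrow> ('a \<times> 'b) set" where
  "mf_graph F = {(x, y). y \<in> F x}"

definition usc :: "('a::topological_space \<Rightarrow> 'b::topological_space set) \<Rightarrow> bool" where
  "usc F \<longleftrightarrow> (\<forall>x V. open V \<and> F x \<subseteq> V \<longrightarrow> (\<exists>U. open U \<and> x \<in> U \<and> (\<Union>z\<in>U. F z) \<subseteq> V))"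

definition usco :: "('a::topological_space \<Rightarrow> 'b::topological_space set) \<Rightarrow> bool" where
  "usco F \<longleftrightarrow> usc F \<and> (\<forall>x. F x \<noteq> {} \<and> compact (F x))"

definition minimal_usco :: "('a::topological_space \<Rightarrow> 'b::topological_space set) \<Rightarrow> bool" where
  "minimal_usco F \<longleftrightarrow> usco F \<and> \<not> (\<exists>G. usco G \<and> mf_graph G \<subset> mf_graph F)"

definition MU :: "('a::topological_space \<Rightarrow> 'b::topological_space set) set" where
  "MU = {F. minimal_usco F}"

definition KX :: "('a \<Rightarrow> 'b::topological_space set) set" where
  "KX = {F. \<forall>x. F x \<noteq> {} \<and> compact (F x)}"

text \<open>The Hausdorff metric. The suprema are suprema of reals, so this is meaningful only for
  nonempty bounded arguments; it is applied to nonempty compact sets only.\<close>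

definition hausdorff_dist :: "'b::metric_space set \<Rightarrow> 'b set \<Rightarrow> real" where
  "hausdorff_dist A B = max (SUP a\<in>A. infdist a B) (SUP b\<in>B. infdist b A)"

definition uc_entourage ::
  "'a::topological_space set \<Rightarrow> real \<Rightarrow> (('a \<Rightarrow> 'b::metric_space set) \<times> ('a \<Rightarrow> 'b set)) set" where
  "uc_entourage K e =
     {(F, G). F \<in> KX \<and> G \<in> KX \<and> (\<forall>x\<in>K. hausdorff_dist (F x) (G x) < e)}"

text \<open>The topology induced by the uniformity with base \<open>uc_entourage K e\<close>: a subset \<open>U\<close> of
  \<open>K(Y)\<^sup>X\<close> is open if it contains, with each \<open>F\<close>, the section at \<open>F\<close> of some basic entourage.\<close>

definition uc_open :: "('a::topological_space \<Rightarrow> 'b::metric_space set) set \<Rightarrow> bool" where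
  "uc_open U \<longleftrightarrow> U \<subseteq> KX \<and>
     (\<forall>F\<in>U. \<exists>K e. compact K \<and> e > 0 \<and> uc_entourage K e `` {F} \<subseteq> U)"

definition tau_uc :: "('a::topological_space \<Rightarrow> 'b::metric_space set) topology" where
  "tau_uc = topology uc_open"

lemma istopology_uc_open: "istopology uc_open"
  unfolding istopology_def
proof (intro conjI allI impI)
  fix S T :: "('a \<Rightarrow> 'b set) set"
  assume S: "uc_open S" and T: "uc_open T"
  have "\<exists>K e. compact K \<and> e > 0 \<and> uc_entourage K e `` {F} \<subseteq> S \<inter> T" if F: "F \<in> S \<inter> T" for F
  proof -
    obtain K1 e1 where 1: "compact K1" "e1 > 0" "uc_entourage K1 e1 `` {F} \<subseteq> S"
      using S F unfolding uc_open_def by blast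
    obtain K2 e2 where 2: "compact K2" "e2 > 0" "uc_entourage K2 e2 `` {F} \<subseteq> T"
      using T F unfolding uc_open_def by blast
    have "uc_entourage (K1 \<union> K2) (min e1 e2) `` {F} \<subseteq> S \<inter> T"
      using 1(3) 2(3) unfolding uc_entourage_def by auto
    then show ?thesis
      using 1 2 by (intro exI[of _ "K1 \<union> K2"] exI[of _ "min e1 e2"]) auto
  qed
  then show "uc_open (S \<inter> T)"
    using S unfolding uc_open_def by blast
next
  fix \<K> :: "('a \<Rightarrow> 'b set) set set"
  assume "\<forall>S\<in>\<K>. uc_open S"
  then show "uc_open (\<Union>\<K>)"
    unfolding uc_open_def by (meson Sup_least UnionE Union_upper order_trans)
qed

lemma openin_tau_uc: "openin tau_uc U \<longleftrightarrow> uc_open U"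
  by (simp add: tau_uc_def istopology_uc_open topology_inverse')

lemma topspace_tau_uc: "topspace (tau_uc :: ('a::topological_space \<Rightarrow> 'b::metric_space set) topology) = KX"
proof -
  have "uc_open (KX :: ('a \<Rightarrow> 'b set) set)"
    unfolding uc_open_def uc_entourage_def
    by (auto intro!: exI[of _ "{}"] exI[of _ "1::real"])
  then show ?thesis
    unfolding topspace_def openin_tau_uc by (auto simp: uc_open_def)
qed

definition MU_uc :: "('a::topological_space \<Rightarrow> 'b::metric_space set) topology" where
  "MU_uc = subtopology tau_uc MU"

lemma topspace_MU_uc:
  "topspace (MU_uc :: ('a::topological_space \<Rightarrow> 'b::metric_space set) topology) = MU"
  by (auto simp: MU_uc_def topspace_tau_uc KX_def MU_def minimal_usco_def usco_def)

definition sigma_compactin :: "'a topology \<Rightarrow> 'a set \<Rightarrow> bool" where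
  "sigma_compactin T S \<longleftrightarrow> (\<exists>\<C>. countable \<C> \<and> (\<forall>C\<in>\<C>. compactin T C) \<and> S = \<Union>\<C>)"

definition locally_sigma_compact_space :: "'a topology \<Rightarrow> bool" where
  "locally_sigma_compact_space T \<longleftrightarrow>
     (\<forall>x\<in>topspace T. \<exists>U N. openin T U \<and> sigma_compactin T N \<and> x \<in> U \<and> U \<subseteq> N)"

end

theory Submission
  imports Defs
begin

text \<open>Why the theorem holds. At an isolated point of \<open>X\<close> a minimal usco map takes a single value,
  chosen freely. Hence for finite \<open>X\<close> the space \<open>MU(X,Y)\<close> is the finite power \<open>Y\<^sup>X\<close>, which is
  locally \<open>\<sigma>\<close>-compact exactly when \<open>Y\<close> is
  (\<open>MU_locally_sigma_compact_finite_domain\<close>, \<open>range_locally_sigma_compact\<close>).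

  For infinite \<open>X\<close>, local \<open>\<sigma>\<close>-compactness has to force local compactness. A
  \<open>\<sigma>\<close>-compact neighbourhood \<open>N\<close> of a constant map contains all minimal maps that are close to the
  constant on some compact \<open>K\<close>; this restricts \<open>X\<close> and \<open>Y\<close> as follows.

  \<^item> Around a non-isolated point of \<open>X\<close> there are infinitely many disjoint nonempty open sets, and
    for two points \<open>a \<noteq> b\<close> of \<open>Y\<close> each set of indices gives a minimal usco map with value \<open>b\<close> on the
    chosen open sets and \<open>a\<close> away from them. These uncountably many maps are at distance at least
    \<open>dist a b\<close> from each other on one compact set, while a compact set of maps contains only
    finitely many of them. So they never all lie in one \<open>\<sigma>\<close>-compact set
    (\<open>two_valued_not_sigma_compact\<close>).
  \<^item> If \<open>Y\<close> is not discrete, then \<open>a\<close> and \<open>b\<close> can be taken so close together that all these maps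
    lie in \<open>N\<close>; hence \<open>X\<close> is discrete (\<open>discrete_domain_or_range\<close>). For any \<open>Y\<close>, the open sets can
    be taken away from \<open>K\<close>, so that the maps agree with the constant on \<open>K\<close>; hence all points
    outside \<open>K\<close> are isolated, and \<open>X\<close> is the sum of a clopen compact set \<open>K'\<close> and a discrete set
    (\<open>clopen_compact_with_discrete_complement\<close>).
  \<^item> If the discrete part is infinite, then \<open>N\<close> contains an infinite power of \<open>Y\<close>, and a diagonal
    argument shows that \<open>Y\<close> is compact (\<open>compact_range\<close>).

  Conversely, suppose that \<open>X\<close> has such a decomposition. If \<open>Y\<close> is discrete, then the
  maps that agree with a given one on \<open>K'\<close> form an open set, and this set is the image of the
  power of \<open>Y\<close> over the discrete part. That image is compact by Tychonoff if \<open>Y\<close> is compact, and it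
  is a single point if the discrete part is empty; a finite discrete part is absorbed into \<open>K'\<close>.
  If \<open>Y\<close> is not discrete, then \<open>X\<close> is discrete and the same argument applies with \<open>K' = {}\<close>
  (\<open>locally_compact_MU_uc\<close>).\<close>

section \<open>The Hausdorff metric on nonempty compact sets\<close>

lemma infdist_attained_compact:
  fixes B :: "'b::metric_space set"
  assumes "compact B" "B \<noteq> {}"
  obtains b where "b \<in> B" "infdist x B = dist x b"
  using setdist_attains_inf[OF assms, of "{x}"]
  by (metis dist_commute infdist_eq_setdist infdist_singleton setdist_sym)

lemma bdd_above_infdist:
  fixes A :: "'b::metric_space set"
  assumes "compact A"
  shows "bdd_above ((\<lambda>a. infdist a B) ` A)"
  by (intro bounded_imp_bdd_above compact_imp_bounded compact_continuous_image assms
      continuous_intros)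

text \<open>On compact sets the infima in the definition are attained, which turns bounds on the Hausdorff
  distance into statements about points; the properties needed below follow from these.\<close>

lemma hausdorff_dist_le_iff:
  fixes A B :: "'b::metric_space set"
  assumes "compact A" "A \<noteq> {}" "compact B" "B \<noteq> {}"
  shows "hausdorff_dist A B \<le> r \<longleftrightarrow>
    (\<forall>a\<in>A. \<exists>b\<in>B. dist a b \<le> r) \<and> (\<forall>b\<in>B. \<exists>a\<in>A. dist a b \<le> r)"
proof -
  have *: "(SUP a\<in>A. infdist a B) \<le> r \<longleftrightarrow> (\<forall>a\<in>A. \<exists>b\<in>B. dist a b \<le> r)"
    if "compact A" "A \<noteq> {}" "compact B" "B \<noteq> {}" for A B :: "'b set"
  proof -
    have "infdist a B \<le> r \<longleftrightarrow> (\<exists>b\<in>B. dist a b \<le> r)" for a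
      by (metis infdist_attained_compact infdist_le2 that(3,4))
    then show ?thesis
      using cSUP_le_iff[OF that(2) bdd_above_infdist[OF that(1)]] by simp
  qed
  show ?thesis
    unfolding hausdorff_dist_def using *[OF assms] *[OF assms(3,4,1,2)]
    by (simp add: dist_commute)
qed

lemma hausdorff_dist_triangle:
  fixes A B C :: "'b::metric_space set"
  assumes A: "compact A" "A \<noteq> {}" and B: "compact B" "B \<noteq> {}" and C: "compact C" "C \<noteq> {}"
  shows "hausdorff_dist A C \<le> hausdorff_dist A B + hausdorff_dist B C"
proof -
  let ?r = "hausdorff_dist A B" and ?s = "hausdorff_dist B C"
  have 1: "(\<forall>a\<in>A. \<exists>b\<in>B. dist a b \<le> ?r) \<and> (\<forall>b\<in>B. \<exists>a\<in>A. dist a b \<le> ?r)"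
    using hausdorff_dist_le_iff[OF A B, of ?r] by simp
  have 2: "(\<forall>b\<in>B. \<exists>c\<in>C. dist b c \<le> ?s) \<and> (\<forall>c\<in>C. \<exists>b\<in>B. dist b c \<le> ?s)"
    using hausdorff_dist_le_iff[OF B C, of ?s] by simp
  have 3: "dist a b \<le> ?r \<Longrightarrow> dist b c \<le> ?s \<Longrightarrow> dist a c \<le> ?r + ?s" for a b c :: 'b
    using dist_triangle[of a c b] by linarith
  show ?thesis
    unfolding hausdorff_dist_le_iff[OF A C] using 1 2 3 by meson
qed

lemma hausdorff_dist_commute: "hausdorff_dist A B = hausdorff_dist B A"
  by (simp add: hausdorff_dist_def max.commute)

lemma hausdorff_dist_self [simp]: "A \<noteq> {} \<Longrightarrow> hausdorff_dist A A = 0"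
  by (simp add: hausdorff_dist_def)

lemma hausdorff_dist_singletons [simp]: "hausdorff_dist {a} {b} = dist a b"
  by (simp add: hausdorff_dist_def dist_commute)

lemma hausdorff_dist_lessD:
  fixes A B :: "'b::metric_space set"
  assumes "compact A" "A \<noteq> {}" "compact B" "B \<noteq> {}" "hausdorff_dist A B < e" "b \<in> B"
  shows "\<exists>a\<in>A. dist a b < e"
  using hausdorff_dist_le_iff[OF assms(1-4), of "hausdorff_dist A B"] assms(5,6)
  by (metis le_less_trans order_refl)

section \<open>Minimal usco maps\<close>

lemma MU_compact: "F \<in> MU \<Longrightarrow> compact (F x)"
  and MU_nonempty: "F \<in> MU \<Longrightarrow> F x \<noteq> {}"
  and MU_usc: "F \<in> MU \<Longrightarrow> usc F"
  by (auto simp: MU_def minimal_usco_def usco_def)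

lemma MU_subset_KX: "F \<in> MU \<Longrightarrow> F \<in> KX"
  by (auto simp: KX_def MU_compact MU_nonempty)

lemma MU_I:
  assumes "usco F" "\<And>G. usco G \<Longrightarrow> (\<And>x. G x \<subseteq> F x) \<Longrightarrow> G = F"
  shows "F \<in> MU"
proof -
  have "\<not> mf_graph G \<subset> mf_graph F" if "usco G" for G
  proof
    assume *: "mf_graph G \<subset> mf_graph F"
    then have "G x \<subseteq> F x" for x
      by (auto simp: mf_graph_def)
    with assms(2)[OF that] have "G = F"
      by blast
    with * show False
      by blast
  qed
  then show ?thesis
    using assms(1) by (auto simp: MU_def minimal_usco_def)
qed

lemma MU_minimal:
  assumes "F \<in> MU" "usco G" "\<And>x. G x \<subseteq> F x"
  shows "G = F"
proof -
  have "mf_graph G \<subseteq> mf_graph F"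
    using assms(3) by (auto simp: mf_graph_def)
  then have "mf_graph G = mf_graph F"
    using assms(1,2) by (auto simp: MU_def minimal_usco_def)
  then show ?thesis
    by (auto simp: mf_graph_def fun_eq_iff set_eq_iff)
qed

lemma usc_nbhd:
  assumes "usc F" "open V" "F x \<subseteq> V"
  obtains U where "open U" "x \<in> U" "\<And>z. z \<in> U \<Longrightarrow> F z \<subseteq> V"
  using assms unfolding usc_def by (metis UN_subset_iff)

lemma uscI:
  assumes "\<And>x V. open V \<Longrightarrow> F x \<subseteq> V \<Longrightarrow> \<exists>U. open U \<and> x \<in> U \<and> (\<forall>z\<in>U. F z \<subseteq> V)"
  shows "usc F"
  using assms unfolding usc_def by (metis UN_subset_iff)

text \<open>At an isolated point upper semicontinuity is no constraint, so a minimal map can be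
  cut down there to a single value.\<close>

lemma MU_singleton_at_isolated:
  assumes F: "F \<in> MU" and x: "open {x}"
  shows "\<exists>y. F x = {y}"
proof -
  obtain y where y: "y \<in> F x"
    using MU_nonempty[OF F] by blast
  define G where "G = F(x := {y})"
  have "usc G"
  proof (rule uscI)
    fix z V assume V: "open V" "G z \<subseteq> V"
    show "\<exists>U. open U \<and> z \<in> U \<and> (\<forall>w\<in>U. G w \<subseteq> V)"
    proof (cases "z = x")
      case True
      then show ?thesis using V x by blast
    next
      case False
      then have "F z \<subseteq> V"
        using V by (simp add: G_def)
      then obtain U where U: "open U" "z \<in> U" "\<And>w. w \<in> U \<Longrightarrow> F w \<subseteq> V"
        using usc_nbhd[OF MU_usc[OF F] V(1)] by metis
      have "G w \<subseteq> F w" for w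
        using y by (simp add: G_def)
      with U show ?thesis by blast
    qed
  qed
  then have "usco G"
    by (auto simp: usco_def G_def MU_compact[OF F] MU_nonempty[OF F])
  then have "G = F"
    by (rule MU_minimal[OF F]) (use y in \<open>simp add: G_def\<close>)
  then show ?thesis
    by (metis G_def fun_upd_same)
qed

lemma continuous_MU:
  assumes "continuous_on UNIV g"
  shows "(\<lambda>x. {g x}) \<in> MU"
proof (rule MU_I)
  have "usc (\<lambda>x. {g x})"
  proof (rule uscI)
    fix x V assume "open V" "{g x} \<subseteq> V"
    then show "\<exists>U. open U \<and> x \<in> U \<and> (\<forall>z\<in>U. {g z} \<subseteq> V)"
      using open_vimage[OF \<open>open V\<close> assms] by (intro exI[of _ "g -` V"]) auto
  qed
  then show "usco (\<lambda>x. {g x})"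
    by (simp add: usco_def)
next
  fix G assume "usco G" "\<And>x. G x \<subseteq> {g x}"
  then show "G = (\<lambda>x. {g x})"
    unfolding usco_def by (metis subset_singletonD ext)
qed

lemma const_MU: "(\<lambda>_. {y}) \<in> MU"
  by (rule continuous_MU) (rule continuous_on_const)

section \<open>Two-valued minimal usco maps\<close>

text \<open>The closure of the graph of the function that is \<open>b\<close> on \<open>U\<close> and \<open>a\<close> on the complement of the
  closure of \<open>U\<close>. For open \<open>U\<close> this function is continuous with dense open domain.\<close>

definition two_valued :: "'b \<Rightarrow> 'b \<Rightarrow> 'a::topological_space set \<Rightarrow> 'a \<Rightarrow> 'b set" where
  "two_valued a b U x =
     {y. y = b \<and> x \<in> closure U \<or> y = a \<and> x \<in> closure (- closure U)}"

lemma two_valued_on_open: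
  assumes "open U" "x \<in> U"
  shows "two_valued a b U x = {b}"
proof -
  have "U \<inter> - closure U = {}"
    using closure_subset by blast
  then have "x \<notin> closure (- closure U)"
    using open_Int_closure_eq_empty[OF assms(1)] assms(2) by blast
  moreover have "x \<in> closure U"
    using assms(2) closure_subset by blast
  ultimately show ?thesis
    by (auto simp: two_valued_def)
qed

lemma two_valued_off_closure:
  assumes "x \<notin> closure U"
  shows "two_valued a b U x = {a}"
  using assms closure_subset[of "- closure U"] by (auto simp: two_valued_def)

lemma two_valued_subset: "two_valued a b U x \<subseteq> {a, b}"
  by (auto simp: two_valued_def)

lemma two_valued_nonempty: "two_valued a b U x \<noteq> {}"
  using closure_subset[of "- closure U"] by (auto simp: two_valued_def)

text \<open>Every usco submap has the forced single value on the dense open set \<open>U \<union> - closure U\<close>, and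
  upper semicontinuity carries forced values to the closure.\<close>

lemma two_valued_MU:
  fixes a b :: "'b::t1_space"
  assumes U: "open U"
  shows "two_valued a b U \<in> MU"
proof (rule MU_I)
  let ?F = "two_valued a b U"
  have "usc ?F"
  proof (rule uscI)
    fix x V assume V: "?F x \<subseteq> V"
    let ?W = "(if b \<in> V then UNIV else - closure U) \<inter>
              (if a \<in> V then UNIV else - closure (- closure U))"
    show "\<exists>W. open W \<and> x \<in> W \<and> (\<forall>z\<in>W. ?F z \<subseteq> V)"
    proof (intro exI[of _ ?W] conjI ballI)
      show "open ?W" by (intro open_Int) auto
      show "x \<in> ?W" using V by (auto simp: two_valued_def)
      show "?F z \<subseteq> V" if "z \<in> ?W" for z
        using that by (auto simp: two_valued_def split: if_splits)
    qed
  qed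
  then show "usco ?F"
    by (simp add: usco_def two_valued_nonempty)
      (meson finite.emptyI finite_insert finite_imp_compact finite_subset two_valued_subset)
next
  fix G assume G: "usco G" and sub: "\<And>x. G x \<subseteq> two_valued a b U x"
  have usc: "usc G" and ne: "\<And>x. G x \<noteq> {}"
    using G by (auto simp: usco_def)
  \<comment> \<open>a value forced on a set persists on its closure: otherwise upper semicontinuity
    would exclude it on a neighbourhood meeting the set\<close>
  have persist: "c \<in> G x" if "x \<in> closure S" "\<And>z. z \<in> S \<Longrightarrow> two_valued a b U z = {c}" for c x S
  proof (rule ccontr)
    assume "c \<notin> G x"
    then have "G x \<subseteq> - {c}" by blast
    then obtain W where W: "open W" "x \<in> W" "\<And>z. z \<in> W \<Longrightarrow> G z \<subseteq> - {c}"
      using usc_nbhd[OF usc, of "- {c}"] by (metis open_Compl closed_singleton)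
    then have "W \<inter> S \<noteq> {}"
      using open_Int_closure_eq_empty[OF W(1)] that(1) by blast
    then obtain z where "z \<in> W" "z \<in> S"
      by blast
    then show False
      using W(3)[of z] that(2)[of z] sub[of z] ne[of z] by blast
  qed
  have "two_valued a b U x \<subseteq> G x" for x
    using persist[of x U b] two_valued_on_open[OF U, of _ a b]
      persist[of x "- closure U" a] two_valued_off_closure[of _ U a b]
    by (auto simp: two_valued_def)
  with sub show "G = two_valued a b U"
    by (intro ext) blast
qed

section \<open>The topology of uniform convergence on compact sets\<close>

text \<open>The section of a basic entourage need not be open, but it contains the open set of all
  maps that stay within some smaller radius on \<open>K\<close>; this is where the triangle inequality
  enters.\<close>

lemma uc_nbhd:
  fixes F :: "'a::topological_space \<Rightarrow> 'b::metric_space set"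
  assumes F: "F \<in> KX" and K: "compact K" and e: "e > 0"
  shows "\<exists>U. uc_open U \<and> F \<in> U \<and> (\<forall>G\<in>U. \<forall>x\<in>K. hausdorff_dist (F x) (G x) < e)"
proof -
  define U where "U = {G \<in> KX. \<exists>r<e. \<forall>x\<in>K. hausdorff_dist (F x) (G x) \<le> r}"
  have "uc_open U"
    unfolding uc_open_def
  proof (intro conjI ballI)
    show "U \<subseteq> KX" by (auto simp: U_def)
    fix G assume "G \<in> U"
    then obtain r where G: "G \<in> KX" and r: "r < e" "\<And>x. x \<in> K \<Longrightarrow> hausdorff_dist (F x) (G x) \<le> r"
      by (auto simp: U_def)
    have "uc_entourage K ((e - r) / 2) `` {G} \<subseteq> U"
    proof
      fix H assume "H \<in> uc_entourage K ((e - r) / 2) `` {G}"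
      then have H: "H \<in> KX" "\<And>x. x \<in> K \<Longrightarrow> hausdorff_dist (G x) (H x) < (e - r) / 2"
        by (auto simp: uc_entourage_def)
      have "hausdorff_dist (F x) (H x) \<le> r + (e - r) / 2" if "x \<in> K" for x
      proof -
        have "hausdorff_dist (F x) (H x) \<le> hausdorff_dist (F x) (G x) + hausdorff_dist (G x) (H x)"
          using F G H(1) by (intro hausdorff_dist_triangle) (auto simp: KX_def)
        with r(2)[OF that] H(2)[OF that] show ?thesis by linarith
      qed
      moreover have "r + (e - r) / 2 < e"
        using r(1) by (simp add: field_simps)
      ultimately show "H \<in> U"
        using H(1) by (auto simp: U_def)
    qed
    then show "\<exists>K e. compact K \<and> e > 0 \<and> uc_entourage K e `` {G} \<subseteq> U"
      using K r(1) by (intro exI[of _ K] exI[of _ "(e - r) / 2"]) auto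
  qed
  moreover have "F \<in> U"
    using F e by (auto simp: U_def KX_def intro!: exI[of _ 0])
  moreover have "\<forall>G\<in>U. \<forall>x\<in>K. hausdorff_dist (F x) (G x) < e"
    by (auto simp: U_def intro: le_less_trans)
  ultimately show ?thesis by blast
qed

text \<open>Topological arguments in \<open>MU(X,Y)\<close> can therefore be carried out with sections of basic
  entourages among minimal maps only.\<close>

lemma openin_MU_uc:
  fixes U :: "('a::topological_space \<Rightarrow> 'b::metric_space set) set"
  shows "openin MU_uc U \<longleftrightarrow> U \<subseteq> MU \<and>
    (\<forall>F\<in>U. \<exists>K e. compact K \<and> e > 0 \<and>
      (\<forall>G\<in>MU. (\<forall>x\<in>K. hausdorff_dist (F x) (G x) < e) \<longrightarrow> G \<in> U))"
    (is "_ \<longleftrightarrow> ?R")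
proof
  assume "openin MU_uc U"
  then obtain T where T: "uc_open T" "U = T \<inter> MU"
    by (auto simp: MU_uc_def openin_subtopology openin_tau_uc)
  have "\<exists>K e. compact K \<and> e > 0 \<and>
      (\<forall>G\<in>MU. (\<forall>x\<in>K. hausdorff_dist (F x) (G x) < e) \<longrightarrow> G \<in> U)" if F: "F \<in> U" for F
  proof -
    obtain K e where K: "compact K" "e > 0" "uc_entourage K e `` {F} \<subseteq> T"
      using T F unfolding uc_open_def by blast
    have "G \<in> U" if "G \<in> MU" "\<forall>x\<in>K. hausdorff_dist (F x) (G x) < e" for G
      using that F T K(3) by (auto simp: uc_entourage_def MU_subset_KX)
    with K show ?thesis by blast
  qed
  with T show ?R by blast
next
  assume R: ?R
  show "openin MU_uc U"
  proof (subst openin_subopen, intro ballI)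
    fix F assume F: "F \<in> U"
    then obtain K e where K: "compact K" "e > 0"
      "\<And>G. G \<in> MU \<Longrightarrow> (\<forall>x\<in>K. hausdorff_dist (F x) (G x) < e) \<Longrightarrow> G \<in> U"
      using R by meson
    obtain T where T: "uc_open T" "F \<in> T" "\<forall>G\<in>T. \<forall>x\<in>K. hausdorff_dist (F x) (G x) < e"
      using uc_nbhd[OF _ K(1,2), of F] R F MU_subset_KX by blast
    have "openin MU_uc (T \<inter> MU)"
      using T(1) by (auto simp: MU_uc_def openin_subtopology openin_tau_uc)
    moreover have "F \<in> T \<inter> MU" "T \<inter> MU \<subseteq> U"
      using R F T K(3) by auto
    ultimately show "\<exists>T. openin MU_uc T \<and> F \<in> T \<and> T \<subseteq> U"
      by blast
  qed
qed

lemma MU_uc_nbhd: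
  fixes F :: "'a::topological_space \<Rightarrow> 'b::metric_space set"
  assumes F: "F \<in> MU" and K: "compact K" and e: "e > 0"
  shows "\<exists>U. openin MU_uc U \<and> F \<in> U \<and> (\<forall>G\<in>U. \<forall>x\<in>K. hausdorff_dist (F x) (G x) < e)"
proof -
  obtain T where T: "uc_open T" "F \<in> T" "\<forall>G\<in>T. \<forall>x\<in>K. hausdorff_dist (F x) (G x) < e"
    using uc_nbhd[OF MU_subset_KX[OF F] K e] by blast
  then have "openin MU_uc (T \<inter> MU)"
    by (auto simp: MU_uc_def openin_subtopology openin_tau_uc)
  with T F show ?thesis by blast
qed

text \<open>Meaningful where \<open>F x\<close> is a singleton, in particular for minimal maps at isolated points.\<close>

definition eval_at :: "'a \<Rightarrow> ('a \<Rightarrow> 'b set) \<Rightarrow> 'b" where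
  "eval_at x F = the_elem (F x)"

lemma continuous_map_eval_at:
  assumes x: "open {x}"
  shows "continuous_map (MU_uc :: ('a::topological_space \<Rightarrow> 'b::metric_space set) topology)
    euclidean (eval_at x)"
  unfolding continuous_map_def
proof (intro conjI allI impI)
  fix V :: "'b set" assume "openin euclidean V"
  then have V: "open V" by simp
  show "openin MU_uc {F \<in> topspace MU_uc. eval_at x F \<in> V}"
    unfolding openin_MU_uc topspace_MU_uc
  proof (intro conjI ballI)
    fix F :: "'a \<Rightarrow> 'b set" assume "F \<in> {F \<in> MU. eval_at x F \<in> V}"
    moreover from this obtain y where y: "F x = {y}"
      using MU_singleton_at_isolated[OF _ x] by blast
    ultimately have "y \<in> V" by (simp add: eval_at_def)
    then obtain e where e: "e > 0" "ball y e \<subseteq> V"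
      using V open_contains_ball by blast
    have "G \<in> {F \<in> MU. eval_at x F \<in> V}"
      if G: "G \<in> MU" "\<forall>z\<in>{x}. hausdorff_dist (F z) (G z) < e" for G
    proof -
      obtain z where z: "G x = {z}"
        using MU_singleton_at_isolated[OF G(1) x] by blast
      then have "dist y z < e" using G(2) y by simp
      then show ?thesis using e(2) G(1) z by (auto simp: eval_at_def)
    qed
    then show "\<exists>K e. compact K \<and> e > 0 \<and> (\<forall>G\<in>MU. (\<forall>x\<in>K. hausdorff_dist (F x) (G x) < e) \<longrightarrow>
        G \<in> {F \<in> MU. eval_at x F \<in> V})"
      using e(1) by (intro exI[of _ "{x}"] exI[of _ e]) auto
  qed auto
qed auto

lemma compact_eval_at:
  assumes "open {x}" "compactin MU_uc C"
  shows "compact (eval_at x ` C)"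
  using image_compactin[OF assms(2) continuous_map_eval_at[OF assms(1)]] by simp

section \<open>Gluing over a clopen set with discrete complement\<close>

definition glue :: "'a set \<Rightarrow> ('a \<Rightarrow> 'b set) \<Rightarrow> ('a \<Rightarrow> 'b) \<Rightarrow> 'a \<Rightarrow> 'b set" where
  "glue K F g x = (if x \<in> K then F x else {g x})"

text \<open>When \<open>K\<close> is open and all points outside it are isolated, neighbourhoods can be chosen inside
  \<open>K\<close> or as single points, so the two parts of a map do not interact.\<close>

lemma usco_replace_off_clopen:
  assumes K: "open K" and iso: "\<And>x. x \<notin> K \<Longrightarrow> open {x}"
    and F: "usco F" and H: "\<And>x. x \<notin> K \<Longrightarrow> H x \<noteq> {} \<and> compact (H x)"
  shows "usco (\<lambda>x. if x \<in> K then F x else H x)"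
proof -
  have "usc (\<lambda>x. if x \<in> K then F x else H x)" (is "usc ?G")
  proof (rule uscI)
    fix x V assume V: "open V" "?G x \<subseteq> V"
    show "\<exists>U. open U \<and> x \<in> U \<and> (\<forall>z\<in>U. ?G z \<subseteq> V)"
    proof (cases "x \<in> K")
      case True
      then obtain U where "open U" "x \<in> U" "\<And>z. z \<in> U \<Longrightarrow> F z \<subseteq> V"
        using usc_nbhd[of F V x] F V by (auto simp: usco_def)
      then show ?thesis
        using True K by (intro exI[of _ "U \<inter> K"]) auto
    next
      case False
      then show ?thesis
        using V iso by (intro exI[of _ "{x}"]) auto
    qed
  qed
  then show ?thesis
    using F H by (simp add: usco_def)
qed

lemma glue_MU:
  fixes F :: "'a::topological_space \<Rightarrow> 'b::topological_space set"
  assumes K: "open K" and iso: "\<And>x. x \<notin> K \<Longrightarrow> open {x}" and F: "F \<in> MU"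
  shows "glue K F g \<in> MU"
proof (rule MU_I)
  have F': "usco F" using F by (simp add: MU_def minimal_usco_def)
  show "usco (glue K F g)"
    unfolding glue_def by (rule usco_replace_off_clopen[OF K iso F']) auto
  fix G assume G: "usco G" "\<And>x. G x \<subseteq> glue K F g x"
  have "(\<lambda>x. if x \<in> K then G x else F x) = F"
  proof (rule MU_minimal[OF F])
    show "usco (\<lambda>x. if x \<in> K then G x else F x)"
      by (rule usco_replace_off_clopen[OF K iso G(1)]) (use F' in \<open>auto simp: usco_def\<close>)
    show "(if x \<in> K then G x else F x) \<subseteq> F x" for x
      using G(2)[of x] by (auto simp: glue_def)
  qed
  then have "G x = F x" if "x \<in> K" for x
    using that by (metis (mono_tags))
  moreover have "G x = {g x}" if "x \<notin> K" for x
    using G(2)[of x] G(1) that unfolding glue_def usco_def by (metis subset_singletonD)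
  ultimately show "G = glue K F g"
    by (auto simp: glue_def fun_eq_iff)
qed

lemma glue_surj:
  assumes iso: "\<And>x. x \<notin> K \<Longrightarrow> open {x}" and G: "G \<in> MU" and eq: "\<And>x. x \<in> K \<Longrightarrow> G x = F x"
  shows "G = glue K F (\<lambda>x. eval_at x G)"
proof
  fix x
  show "G x = glue K F (\<lambda>x. eval_at x G) x"
  proof (cases "x \<in> K")
    case False
    then obtain y where "G x = {y}"
      using MU_singleton_at_isolated[OF G iso] by blast
    with False show ?thesis by (simp add: glue_def eval_at_def)
  qed (simp add: glue_def eq)
qed

lemma compact_isolated_finite:
  assumes "compact S" "\<And>x. x \<in> S \<Longrightarrow> open {x}"
  shows "finite S"
proof -
  have "\<forall>T\<in>(\<lambda>x. {x}) ` S. open T" "S \<subseteq> \<Union>((\<lambda>x. {x}) ` S)"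
    using assms(2) by auto
  then obtain D where "D \<subseteq> (\<lambda>x. {x}) ` S" "finite D" "S \<subseteq> \<Union>D"
    using assms(1) unfolding compact_eq_Heine_Borel by meson
  then show ?thesis
    by (metis (no_types, lifting) finite.emptyI finite_Union finite_insert finite_subset imageE subsetD)
qed

text \<open>A compact set meets the discrete part \<open>- K\<close> in a finite set, so there uniform convergence on
  compact sets is pointwise convergence: the domain carries the product topology.\<close>

lemma continuous_map_glue:
  fixes F :: "'a::t2_space \<Rightarrow> 'b::metric_space set"
  assumes K: "open K" and iso: "\<And>x. x \<notin> K \<Longrightarrow> open {x}" and F: "F \<in> MU"
  shows "continuous_map euclidean MU_uc (glue K F)"
  unfolding continuous_map_def
proof (intro conjI allI impI)
  show "glue K F \<in> topspace euclidean \<rightarrow> topspace MU_uc"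
    using glue_MU[OF K iso F] by (simp add: topspace_MU_uc)
  fix U :: "('a \<Rightarrow> 'b set) set" assume U: "openin MU_uc U"
  have "\<exists>T. open T \<and> g \<in> T \<and> T \<subseteq> {g. glue K F g \<in> U}" if g: "glue K F g \<in> U" for g
  proof -
    obtain L e where L: "compact L" "e > 0"
      "\<And>G. G \<in> MU \<Longrightarrow> (\<forall>x\<in>L. hausdorff_dist (glue K F g x) (G x) < e) \<Longrightarrow> G \<in> U"
      using U g unfolding openin_MU_uc by meson
    have "compact (L - K)"
      using L(1) K by (simp add: compact_diff)
    then have fin: "finite (L - K)"
      using compact_isolated_finite iso by blast
    define T where "T = {h. \<forall>x\<in>L - K. h x \<in> ball (g x) e}"
    have "open T"
      using product_topology_basis'[OF fin, of "\<lambda>x. ball (g x) e" "\<lambda>x. x"] by (simp add: T_def)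
    moreover have "g \<in> T"
      using L(2) by (simp add: T_def)
    moreover have "glue K F h \<in> U" if "h \<in> T" for h
    proof -
      have "hausdorff_dist (glue K F g x) (glue K F h x) < e" if "x \<in> L" for x
        using \<open>h \<in> T\<close> that L(2) MU_nonempty[OF F] by (auto simp: glue_def T_def)
      moreover have "glue K F h \<in> MU"
        by (rule glue_MU[OF K iso F])
      ultimately show ?thesis
        using L(3) by blast
    qed
    ultimately show ?thesis by blast
  qed
  then have "open {g. glue K F g \<in> U}"
    by (subst open_subopen) blast
  then show "openin euclidean {x \<in> topspace euclidean. glue K F x \<in> U}"
    by simp
qed

lemma compactin_glue_image:
  fixes F :: "'a::t2_space \<Rightarrow> 'b::metric_space set"
  assumes K: "open K" and iso: "\<And>x. x \<notin> K \<Longrightarrow> open {x}" and F: "F \<in> MU"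
    and C: "\<And>x. compact (C x)"
  shows "compactin MU_uc (glue K F ` (Pi\<^sub>E UNIV C))"
proof -
  have "compactin (product_topology (\<lambda>_. euclidean) UNIV) (Pi\<^sub>E UNIV C)"
    using C by (simp add: compactin_PiE)
  then have "compactin euclidean (Pi\<^sub>E UNIV C)"
    by (simp only: euclidean_product_topology)
  then show ?thesis
    using image_compactin continuous_map_glue[OF K iso F] by blast
qed

text \<open>If every point of \<open>Y\<close> is isolated, then the set \<open>F x\<close> is itself an open neighbourhood of
  \<open>F x\<close>, so no new values appear near \<open>x\<close>; being compact, \<open>F x\<close> is also finite.\<close>

lemma finite_image_discrete:
  fixes F :: "'a::topological_space \<Rightarrow> 'b::topological_space set"
  assumes F: "F \<in> MU" and K: "compact K" and disc: "\<And>y::'b. open {y}"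
  shows "finite (\<Union>x\<in>K. F x)"
proof -
  have op: "open S" for S :: "'b set"
    using open_UN[of S "\<lambda>y. {y}"] disc by simp
  have "\<exists>U. open U \<and> x \<in> U \<and> (\<forall>z\<in>U. F z \<subseteq> F x)" for x
    by (rule usc_nbhd[OF MU_usc[OF F] op[of "F x"] order_refl]) (intro exI conjI ballI)
  then obtain U where U: "\<And>x. open (U x) \<and> x \<in> U x \<and> (\<forall>z\<in>U x. F z \<subseteq> F x)"
    by metis
  have "\<And>x. x \<in> K \<Longrightarrow> open (U x)" "K \<subseteq> (\<Union>x\<in>K. U x)"
    using U by blast+
  then obtain J where J: "J \<subseteq> K" "finite J" "K \<subseteq> (\<Union>x\<in>J. U x)"
    by (rule compactE_image[OF K])
  have "finite (F x)" for x
    using compact_isolated_finite[OF MU_compact[OF F]] disc by blast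
  then have "finite (\<Union>x\<in>J. F x)"
    using J(2) by blast
  moreover have "(\<Union>x\<in>K. F x) \<subseteq> (\<Union>x\<in>J. F x)"
    using J(3) U by blast
  ultimately show ?thesis
    using finite_subset by blast
qed

text \<open>The finitely many values on \<open>K\<close> are uniformly isolated in \<open>Y\<close>, so uniform closeness to \<open>F\<close>
  on \<open>K\<close> is agreement with \<open>F\<close> on \<open>K\<close>.\<close>

lemma discrete_close_imp_equal:
  fixes F :: "'a::topological_space \<Rightarrow> 'b::metric_space set"
  assumes F: "F \<in> MU" and K: "compact K" and disc: "\<And>y::'b. open {y}"
  shows "\<exists>e>0. \<forall>G\<in>MU. (\<forall>x\<in>K. hausdorff_dist (F x) (G x) < e) \<longrightarrow> (\<forall>x\<in>K. G x = F x)"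
proof -
  let ?S = "\<Union>x\<in>K. F x"
  have fin: "finite ?S"
    by (rule finite_image_discrete[OF F K disc])
  have "\<exists>r>0. ball y r \<subseteq> {y}" for y :: 'b
    using disc[of y] open_contains_ball by blast
  then obtain r where r: "\<And>y::'b. r y > 0 \<and> ball y (r y) \<subseteq> {y}" by metis
  define e where "e = Min (insert 1 (r ` ?S))"
  have e: "e > 0" using fin r by (simp add: e_def)
  have er: "e \<le> r y" if "y \<in> ?S" for y
    unfolding e_def using fin that by (intro Min_le) auto
  have eq: "z = y" if "y \<in> ?S" "dist y z < e" for y z
    using r[of y] er[OF that(1)] that(2) by (auto simp: subset_iff)
  have "G x = F x" if G: "G \<in> MU" "\<forall>x\<in>K. hausdorff_dist (F x) (G x) < e" and x: "x \<in> K" for G x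
  proof
    note c = MU_compact[OF F] MU_nonempty[OF F] MU_compact[OF G(1)] MU_nonempty[OF G(1)]
    have d: "hausdorff_dist (F x) (G x) < e" "hausdorff_dist (G x) (F x) < e"
      using G(2) x by (auto simp: hausdorff_dist_commute)
    show "G x \<subseteq> F x"
      using hausdorff_dist_lessD[OF c d(1)] eq x by blast
    show "F x \<subseteq> G x"
      using hausdorff_dist_lessD[OF c(3,4,1,2) d(2)] eq x by (metis UN_I dist_commute subsetI)
  qed
  with e show ?thesis by blast
qed

text \<open>The maps that agree with \<open>F\<close> on \<open>K\<close> are the neighbourhood. They form an open set because
  closeness on \<open>K\<close> means agreement on \<open>K\<close>, and they lie in a compact set because they are
  parametrised by the power of \<open>Y\<close> over \<open>- K\<close>.\<close>

lemma locally_compact_MU_uc: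
  fixes K :: "'a::t2_space set"
  assumes K: "open K" "compact K" and iso: "\<And>x. x \<notin> K \<Longrightarrow> open {x}"
    and Y: "compact (UNIV :: 'b set) \<or> K = UNIV"
    and disc: "K = {} \<or> (\<forall>y::'b. open {y})"
  shows "locally_compact_space (MU_uc :: ('a \<Rightarrow> 'b::metric_space set) topology)"
  unfolding locally_compact_space_def topspace_MU_uc
proof
  fix F :: "'a \<Rightarrow> 'b set" assume F: "F \<in> MU"
  define U where "U = {G \<in> MU. \<forall>x\<in>K. G x = F x}"
  have "openin MU_uc U"
    unfolding openin_MU_uc
  proof (intro conjI ballI)
    fix G assume "G \<in> U"
    then have G: "G \<in> MU" "\<forall>x\<in>K. G x = F x" by (auto simp: U_def)
    have "\<exists>e>0. \<forall>H\<in>MU. (\<forall>x\<in>K. hausdorff_dist (G x) (H x) < e) \<longrightarrow> (\<forall>x\<in>K. H x = G x)"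
    proof (cases "K = {}")
      case False
      then show ?thesis using discrete_close_imp_equal[OF G(1) K(2)] disc by blast
    qed (auto intro: exI[of _ 1])
    then obtain e where "e > 0"
      "\<forall>H\<in>MU. (\<forall>x\<in>K. hausdorff_dist (G x) (H x) < e) \<longrightarrow> (\<forall>x\<in>K. H x = G x)"
      by blast
    then show "\<exists>K e. compact K \<and> e > 0 \<and>
        (\<forall>H\<in>MU. (\<forall>x\<in>K. hausdorff_dist (G x) (H x) < e) \<longrightarrow> H \<in> U)"
      using G(2) K(2) by (intro exI[of _ K] exI[of _ e]) (simp add: U_def)
  qed (auto simp: U_def)
  moreover have "F \<in> U" using F by (simp add: U_def)
  moreover have "\<exists>C. compactin MU_uc C \<and> U \<subseteq> C"
  proof (cases "K = UNIV")
    case True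
    then have "U \<subseteq> {F}" by (auto simp: U_def)
    then show ?thesis
      using F by (intro exI[of _ "{F}"]) (simp add: topspace_MU_uc)
  next
    case False
    then have "compactin MU_uc (glue K F ` Pi\<^sub>E UNIV (\<lambda>_. UNIV))"
      using Y by (intro compactin_glue_image[OF K(1) iso F]) auto
    moreover have "U \<subseteq> glue K F ` Pi\<^sub>E UNIV (\<lambda>_. UNIV)"
    proof
      fix G assume "G \<in> U"
      then have "G = glue K F (\<lambda>x. eval_at x G)"
        by (intro glue_surj iso) (auto simp: U_def)
      then show "G \<in> glue K F ` Pi\<^sub>E UNIV (\<lambda>_. UNIV)" by auto
    qed
    ultimately show ?thesis by blast
  qed
  ultimately show "\<exists>U C. openin MU_uc U \<and> compactin MU_uc C \<and> F \<in> U \<and> U \<subseteq> C"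
    by blast
qed

section \<open>Obstructions to local sigma-compactness\<close>

text \<open>The Hausdorff property allows splitting off an open set from a neighbourhood of \<open>p\<close> while
  keeping a smaller neighbourhood of \<open>p\<close>; since \<open>p\<close> is not isolated, this can be repeated forever.\<close>

lemma disjoint_open_sequence:
  fixes p :: "'a::t2_space"
  assumes V: "open V" "p \<in> V" and p: "\<not> open {p}"
  obtains W :: "nat \<Rightarrow> 'a set" where "\<And>n. open (W n)" "\<And>n. W n \<noteq> {}" "\<And>n. W n \<subseteq> V"
    "\<And>m n. m \<noteq> n \<Longrightarrow> W m \<inter> W n = {}"
proof -
  have step: "\<exists>T W. open T \<and> p \<in> T \<and> T \<subseteq> S \<and> open W \<and> W \<noteq> {} \<and> W \<subseteq> S \<and> W \<inter> T = {}"
    if S: "open S" "p \<in> S" for S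
  proof -
    have "S \<noteq> {p}" using S(1) p by metis
    then obtain x where x: "x \<in> S" "x \<noteq> p" using S(2) by blast
    then obtain A B where AB: "open A" "open B" "x \<in> A" "p \<in> B" "A \<inter> B = {}"
      using hausdorff by metis
    show ?thesis
      by (rule exI[of _ "B \<inter> S"], rule exI[of _ "A \<inter> S"]) (use S x AB in auto)
  qed
  have "\<exists>S. \<forall>n. (open (S n) \<and> p \<in> S n \<and> S n \<subseteq> V) \<and>
      (S (Suc n) \<subseteq> S n \<and> (\<exists>W. open W \<and> W \<noteq> {} \<and> W \<subseteq> S n \<and> W \<inter> S (Suc n) = {}))"
    by (rule dependent_nat_choice[of "\<lambda>_ S. open S \<and> p \<in> S \<and> S \<subseteq> V"
          "\<lambda>_ S T. T \<subseteq> S \<and> (\<exists>W. open W \<and> W \<noteq> {} \<and> W \<subseteq> S \<and> W \<inter> T = {})"])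
      (use V step in \<open>blast, meson order_trans step\<close>)
  then obtain S where S0: "\<forall>n. (open (S n) \<and> p \<in> S n \<and> S n \<subseteq> V) \<and>
      (S (Suc n) \<subseteq> S n \<and> (\<exists>W. open W \<and> W \<noteq> {} \<and> W \<subseteq> S n \<and> W \<inter> S (Suc n) = {}))"
    by (rule exE)
  have S: "\<And>n. open (S n) \<and> p \<in> S n \<and> S n \<subseteq> V" "\<And>n. S (Suc n) \<subseteq> S n"
    "\<And>n. \<exists>W. open W \<and> W \<noteq> {} \<and> W \<subseteq> S n \<and> W \<inter> S (Suc n) = {}"
    using S0 by simp_all
  obtain W where W: "\<And>n. open (W n) \<and> W n \<noteq> {} \<and> W n \<subseteq> S n \<and> W n \<inter> S (Suc n) = {}"
    using choice[OF allI[OF S(3)]] by (rule exE) (rule that, rule spec)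
  have dec: "S n \<subseteq> S m" if "m \<le> n" for m n
    using lift_Suc_antimono_le[of S, OF S(2) that] .
  have disj: "W m \<inter> W n = {}" if "m < n" for m n
  proof -
    have "S n \<subseteq> S (Suc m)"
      using that by (intro dec) simp
    then show ?thesis
      using W[of m] W[of n] by blast
  qed
  show thesis
  proof (rule that[of W])
    show "W m \<inter> W n = {}" if "m \<noteq> n" for m n
      using disj[of m n] disj[of n m] that by (cases m n rule: linorder_cases) auto
  qed (use W S(1) in blast)+
qed

text \<open>Cover \<open>C\<close> by open sets of radius \<open>d / 2\<close> with respect to distance on \<open>L\<close>; each contains at most
  one element of the \<open>d\<close>-separated family.\<close>

lemma finite_separated_compactin:
  fixes C :: "('a::topological_space \<Rightarrow> 'b::metric_space set) set"
  assumes C: "compactin MU_uc C" and L: "compact L" and R: "R \<subseteq> MU" and d: "d > 0"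
    and sep: "\<And>F G. F \<in> R \<Longrightarrow> G \<in> R \<Longrightarrow> F \<noteq> G \<Longrightarrow> \<exists>x\<in>L. hausdorff_dist (F x) (G x) \<ge> d"
  shows "finite (C \<inter> R)"
proof -
  have CM: "C \<subseteq> MU"
    using compactin_subset_topspace[OF C] by (simp add: topspace_MU_uc)
  have "\<exists>U. openin MU_uc U \<and> F \<in> U \<and> (\<forall>G\<in>U. \<forall>x\<in>L. hausdorff_dist (F x) (G x) < d / 2)"
    if "F \<in> C" for F
    using MU_uc_nbhd[OF _ L, of F "d / 2"] that CM d by auto
  then obtain U where U: "\<And>F. F \<in> C \<Longrightarrow> openin MU_uc (U F) \<and> F \<in> U F \<and>
      (\<forall>G\<in>U F. \<forall>x\<in>L. hausdorff_dist (F x) (G x) < d / 2)"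
    by metis
  have "(\<forall>T\<in>U ` C. openin MU_uc T) \<and> C \<subseteq> \<Union>(U ` C)"
    using U by blast
  then obtain D where "finite D" "D \<subseteq> U ` C" "C \<subseteq> \<Union>D"
    using C unfolding compactin_def by meson
  then obtain J where J: "J \<subseteq> C" "finite J" "C \<subseteq> \<Union>(U ` J)"
    by (metis finite_subset_image)
  have "finite (U H \<inter> R)" if H: "H \<in> C" for H
  proof -
    have "F = G" if F: "F \<in> U H \<inter> R" and G: "G \<in> U H \<inter> R" for F G
    proof (rule ccontr)
      assume "F \<noteq> G"
      then obtain x where x: "x \<in> L" "hausdorff_dist (F x) (G x) \<ge> d"
        using sep F G by blast
      have "F \<in> MU" "G \<in> MU" "H \<in> MU"
        using F G H R CM by auto
      then have "hausdorff_dist (F x) (G x) \<le> hausdorff_dist (F x) (H x) + hausdorff_dist (H x) (G x)"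
        by (intro hausdorff_dist_triangle MU_compact MU_nonempty)
      moreover have "hausdorff_dist (F x) (H x) < d / 2" "hausdorff_dist (H x) (G x) < d / 2"
        using U[OF H] F G x(1) by (auto simp: hausdorff_dist_commute[of "F x"])
      ultimately show False using x(2) by linarith
    qed
    then have "U H \<inter> R = {} \<or> (\<exists>F. U H \<inter> R = {F})" by blast
    then show ?thesis by (metis finite.emptyI finite.insertI)
  qed
  then have "finite (\<Union>H\<in>J. U H \<inter> R)"
    using J by blast
  then show ?thesis
    by (rule rev_finite_subset) (use J(3) in blast)
qed

text \<open>The maps that switch to \<open>b\<close> on the union of a subfamily of disjoint open sets \<open>W n\<close> are
  indexed by the sets of natural numbers. Two of them differ by exactly \<open>dist a b\<close> on some \<open>W n\<close>.\<close>

lemma two_valued_not_sigma_compact: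
  fixes a b :: "'b::metric_space" and V L :: "'a::t2_space set"
  assumes V: "open V" "p \<in> V" "V \<subseteq> L" and L: "compact L" and p: "\<not> open {p}" and ab: "a \<noteq> b"
    and N: "sigma_compactin MU_uc N"
    and sub: "\<And>U. open U \<Longrightarrow> U \<subseteq> V \<Longrightarrow> two_valued a b U \<in> N"
  shows False
proof -
  obtain W :: "nat \<Rightarrow> 'a set" where W: "\<And>n. open (W n)" "\<And>n. W n \<noteq> {}" "\<And>n. W n \<subseteq> V"
    "\<And>m n. m \<noteq> n \<Longrightarrow> W m \<inter> W n = {}"
    using disjoint_open_sequence[OF V(1,2) p] by metis
  define F where "F A = two_valued a b (\<Union>n\<in>A. W n)" for A
  have op: "open (\<Union>n\<in>A. W n)" for A using W(1) by blast
  have F: "F A \<in> MU" for A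
    unfolding F_def by (rule two_valued_MU[OF op])
  have sep1: "\<exists>x\<in>L. hausdorff_dist (F A x) (F B x) = dist a b" if "n \<in> A" "n \<notin> B" for A B n
  proof -
    obtain x where x: "x \<in> W n" using W(2) by blast
    have "F A x = {b}"
      unfolding F_def using x that by (intro two_valued_on_open[OF op]) blast
    moreover have "W n \<inter> (\<Union>m\<in>B. W m) = {}"
    proof -
      have "W n \<inter> W m = {}" if "m \<in> B" for m
        using W(4)[of n m] that \<open>n \<notin> B\<close> by metis
      then show ?thesis by blast
    qed
    then have "x \<notin> closure (\<Union>m\<in>B. W m)"
      using open_Int_closure_eq_empty[OF W(1)] x by blast
    then have "F B x = {a}"
      unfolding F_def by (rule two_valued_off_closure)
    ultimately have "hausdorff_dist (F A x) (F B x) = dist a b"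
      by (simp add: dist_commute)
    moreover have "x \<in> L"
      using x W(3) V(3) by blast
    ultimately show ?thesis by blast
  qed
  have sep: "\<exists>x\<in>L. hausdorff_dist (F A x) (F B x) \<ge> dist a b" if "A \<noteq> B" for A B
  proof -
    from that obtain n where "n \<in> A \<and> n \<notin> B \<or> n \<in> B \<and> n \<notin> A" by blast
    then show ?thesis
      using sep1[of n A B] sep1[of n B A] by (metis hausdorff_dist_commute order_refl)
  qed
  have sep_range: "\<exists>x\<in>L. hausdorff_dist (G x) (H x) \<ge> dist a b"
    if "G \<in> range F" "H \<in> range F" "G \<noteq> H" for G H
  proof -
    from \<open>G \<in> range F\<close> obtain A where "G = F A" by blast
    moreover from \<open>H \<in> range F\<close> obtain B where "H = F B" by blast
    ultimately show ?thesis
      using sep[of A B] that(3) by metis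
  qed
  have inj: "inj F"
  proof (rule injI, rule ccontr)
    fix A B assume "F A = F B" "A \<noteq> B"
    with sep[of A B] MU_nonempty[OF F, of B] ab show False by auto
  qed
  obtain \<C> where C: "countable \<C>" "\<And>C. C \<in> \<C> \<Longrightarrow> compactin MU_uc C" "N = \<Union>\<C>"
    using N unfolding sigma_compactin_def by blast
  have "finite (C \<inter> range F)" if "C \<in> \<C>" for C
    by (rule finite_separated_compactin[OF C(2)[OF that] L, where d = "dist a b"])
      (use F ab sep_range in auto)
  then have "countable (\<Union>C\<in>\<C>. C \<inter> range F)"
    using C(1) by (intro countable_UN) (auto intro: countable_finite)
  moreover have "range F \<subseteq> (\<Union>C\<in>\<C>. C \<inter> range F)"
  proof -
    have "F A \<in> N" for A
      unfolding F_def using W(3) by (intro sub op) blast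
    then show ?thesis using C(3) by auto
  qed
  ultimately have "countable (range F)"
    using countable_subset by blast
  then have "countable (UNIV :: nat set set)"
    using inj countable_image_inj_on by blast
  then have "range (from_nat_into (UNIV :: nat set set)) = Pow UNIV"
    by (simp add: range_from_nat_into)
  then show False
    using Cantors_theorem[of UNIV] by blast
qed


section \<open>Finite domains\<close>

lemma finite_imp_isolated:
  assumes "finite (UNIV :: 'a::t1_space set)"
  shows "open {x :: 'a}"
proof -
  have "finite (UNIV - {x})"
    using assms by simp
  then have "closed (UNIV - {x})"
    by (rule finite_imp_closed)
  then show ?thesis
    by (simp add: closed_def Diff_eq)
qed

text \<open>Constant maps embed \<open>Y\<close> into \<open>MU(X,Y)\<close>, and evaluation at an isolated point is a continuous
  left inverse of this embedding.\<close>

lemma range_locally_sigma_compact: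
  assumes M: "locally_sigma_compact_space (MU_uc :: ('a::topological_space \<Rightarrow> 'b::metric_space set) topology)"
    and p: "open {p :: 'a}"
  shows "locally_sigma_compact_space (euclidean :: 'b topology)"
  unfolding locally_sigma_compact_space_def
proof
  fix y :: 'b
  obtain U N where U: "openin MU_uc U" "(\<lambda>_::'a. {y}) \<in> U" and N: "sigma_compactin MU_uc N" "U \<subseteq> N"
    using M const_MU[of y] unfolding locally_sigma_compact_space_def topspace_MU_uc by blast
  define V where "V = {z. (\<lambda>_::'a. {z}) \<in> U}"
  have "open V"
    unfolding open_contains_ball
  proof
    fix z assume "z \<in> V"
    then have "(\<lambda>_. {z}) \<in> U"
      by (simp add: V_def)
    then obtain K e where K: "e > 0"
      "\<And>G. G \<in> MU \<Longrightarrow> (\<forall>x\<in>K. hausdorff_dist {z} (G x) < e) \<Longrightarrow> G \<in> U"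
      using U(1) unfolding openin_MU_uc by meson
    have "ball z e \<subseteq> V"
    proof
      fix w assume "w \<in> ball z e"
      then show "w \<in> V"
        unfolding V_def using K(2)[OF const_MU, of w] by simp
    qed
    then show "\<exists>e>0. ball z e \<subseteq> V"
      using K(1) by blast
  qed
  obtain \<C> where C: "countable \<C>" "\<And>C. C \<in> \<C> \<Longrightarrow> compactin MU_uc C" "N = \<Union>\<C>"
    using N(1) unfolding sigma_compactin_def by blast
  have "sigma_compactin euclidean (eval_at p ` N)"
    unfolding sigma_compactin_def
  proof (intro exI[of _ "(\<lambda>C. eval_at p ` C) ` \<C>"] conjI ballI)
    show "countable ((\<lambda>C. eval_at p ` C) ` \<C>)"
      using C(1) by (rule countable_image)
    show "compactin euclidean D" if "D \<in> (\<lambda>C. eval_at p ` C) ` \<C>" for D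
      using that C(2) compact_eval_at[OF p] by auto
    show "eval_at p ` N = \<Union>((\<lambda>C. eval_at p ` C) ` \<C>)"
      using C(3) by blast
  qed
  moreover have "V \<subseteq> eval_at p ` N"
  proof
    fix z assume "z \<in> V"
    then have "(\<lambda>_. {z}) \<in> N" "eval_at p (\<lambda>_::'a. {z}) = z"
      using N(2) by (auto simp: V_def eval_at_def)
    then show "z \<in> eval_at p ` N" by force
  qed
  ultimately show "\<exists>U N. openin euclidean U \<and> sigma_compactin euclidean N \<and> y \<in> U \<and> U \<subseteq> N"
    using \<open>open V\<close> U(2) by (intro exI[of _ V] exI[of _ "eval_at p ` N"]) (simp add: V_def)
qed

text \<open>All points are isolated, so gluing over the empty set parametrises \<open>MU(X,Y)\<close> by the power of
  \<open>Y\<close>. As \<open>X\<close> is finite, a product of \<open>\<sigma>\<close>-compact sets is again a countable union of products of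
  compact sets.\<close>

lemma MU_locally_sigma_compact_finite_domain:
  assumes X: "finite (UNIV :: 'a::t2_space set)"
    and Y: "locally_sigma_compact_space (euclidean :: 'b::metric_space topology)"
  shows "locally_sigma_compact_space (MU_uc :: ('a \<Rightarrow> 'b set) topology)"
  unfolding locally_sigma_compact_space_def topspace_MU_uc
proof
  fix F :: "'a \<Rightarrow> 'b set" assume F: "F \<in> MU"
  have iso: "open {x :: 'a}" for x
    by (rule finite_imp_isolated[OF X])
  have "\<exists>U \<C>. open U \<and> y \<in> U \<and> countable \<C> \<and> (\<forall>C\<in>\<C>. compact C) \<and> U \<subseteq> \<Union>\<C>" for y :: 'b
  proof -
    have "\<exists>U. open U \<and> (\<exists>N. sigma_compactin euclidean N \<and> y \<in> U \<and> U \<subseteq> N)"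
      using Y unfolding locally_sigma_compact_space_def by simp
    then obtain U N where U: "open U" "y \<in> U" "U \<subseteq> N" and N: "sigma_compactin euclidean N"
      by blast
    obtain \<C> where "countable \<C>" "\<forall>C\<in>\<C>. compact C" "N = \<Union>\<C>"
      using N unfolding sigma_compactin_def compactin_euclidean_iff by blast
    with U show ?thesis
      by (intro exI[of _ U] exI[of _ \<C>]) blast
  qed
  then obtain U \<C> where UC: "\<And>y::'b. open (U y) \<and> y \<in> U y \<and> countable (\<C> y) \<and>
      (\<forall>C\<in>\<C> y. compact C) \<and> U y \<subseteq> \<Union>(\<C> y)"
    by metis
  define f where "f x = eval_at x F" for x
  define W where "W = {G \<in> MU. \<forall>x. eval_at x G \<in> U (f x)}"
  \<comment> \<open>\<open>c\<close> chooses one of the countably many compact pieces in each coordinate\<close>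
  define N where "N = (\<Union>c\<in>Pi\<^sub>E UNIV (\<lambda>x. \<C> (f x)). glue {} F ` Pi\<^sub>E UNIV c)"
  have "openin MU_uc (\<Inter>x. {G \<in> topspace MU_uc. eval_at x G \<in> U (f x)})"
  proof (intro openin_INT2)
    show "openin MU_uc {G \<in> topspace MU_uc. eval_at x G \<in> U (f x)}" for x
      using openin_continuous_map_preimage[OF continuous_map_eval_at[OF iso]] UC by auto
  qed (use X in auto)
  moreover have "(\<Inter>x. {G \<in> topspace MU_uc. eval_at x G \<in> U (f x)}) = W"
    by (auto simp: W_def topspace_MU_uc)
  ultimately have "openin MU_uc W" by simp
  moreover have "F \<in> W"
    using F UC by (simp add: W_def f_def)
  moreover have "sigma_compactin MU_uc N"
    unfolding sigma_compactin_def
  proof (intro exI conjI ballI)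
    show "N = \<Union>((\<lambda>c. glue {} F ` Pi\<^sub>E UNIV c) ` Pi\<^sub>E UNIV (\<lambda>x. \<C> (f x)))"
      by (simp add: N_def)
    show "countable ((\<lambda>c. glue {} F ` Pi\<^sub>E UNIV c) ` Pi\<^sub>E UNIV (\<lambda>x. \<C> (f x)))"
      using X UC by (intro countable_image countable_PiE) auto
    show "compactin MU_uc D"
      if "D \<in> (\<lambda>c. glue {} F ` Pi\<^sub>E UNIV c) ` Pi\<^sub>E UNIV (\<lambda>x. \<C> (f x))" for D
    proof -
      obtain c where c: "c \<in> Pi\<^sub>E UNIV (\<lambda>x. \<C> (f x))" "D = glue {} F ` Pi\<^sub>E UNIV c"
        using \<open>D \<in> _\<close> by blast
      have "compact (c x)" for x
        using c(1) UC by (auto simp: PiE_iff)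
      then show ?thesis
        unfolding c(2) by (intro compactin_glue_image F iso) simp_all
    qed
  qed
  moreover have "W \<subseteq> N"
  proof
    fix G assume G: "G \<in> W"
    then have "\<exists>C. C \<in> \<C> (f x) \<and> eval_at x G \<in> C" for x
      using UC[of "f x"] unfolding W_def by blast
    then obtain c where c: "\<And>x. c x \<in> \<C> (f x) \<and> eval_at x G \<in> c x"
      by metis
    have "G = glue {} F (\<lambda>x. eval_at x G)"
      using G by (intro glue_surj iso) (auto simp: W_def)
    moreover have "(\<lambda>x. eval_at x G) \<in> Pi\<^sub>E UNIV c" "c \<in> Pi\<^sub>E UNIV (\<lambda>x. \<C> (f x))"
      using c by auto
    ultimately show "G \<in> N"
      unfolding N_def by blast
  qed
  ultimately show "\<exists>U N. openin MU_uc U \<and> sigma_compactin MU_uc N \<and> F \<in> U \<and> U \<subseteq> N"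
    by blast
qed

lemma locally_compact_imp_locally_sigma_compact:
  assumes "locally_compact_space T"
  shows "locally_sigma_compact_space T"
proof -
  have "sigma_compactin T C" if "compactin T C" for C
    unfolding sigma_compactin_def using that by (intro exI[of _ "{C}"]) auto
  with assms show ?thesis
    unfolding locally_compact_space_def locally_sigma_compact_space_def by metis
qed

section \<open>Infinite domains\<close>

lemma sigma_compact_nbhd_of_const:
  fixes y :: "'b::metric_space"
  assumes M: "locally_sigma_compact_space (MU_uc :: ('a::topological_space \<Rightarrow> 'b set) topology)"
  shows "\<exists>(N :: ('a \<Rightarrow> 'b set) set) K e. sigma_compactin MU_uc N \<and> compact K \<and> e > 0 \<and>
    (\<forall>G\<in>MU. (\<forall>x\<in>K. hausdorff_dist {y} (G x) < e) \<longrightarrow> G \<in> N)"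
proof -
  obtain U N where U: "openin MU_uc U" "(\<lambda>_::'a. {y}) \<in> U" and N: "sigma_compactin MU_uc N" "U \<subseteq> N"
    using M const_MU[of y] unfolding locally_sigma_compact_space_def topspace_MU_uc by blast
  obtain K e where "compact K" "e > 0"
    "\<forall>G\<in>MU. (\<forall>x\<in>K. hausdorff_dist {y} (G x) < e) \<longrightarrow> G \<in> U"
    using U unfolding openin_MU_uc by meson
  with N show ?thesis
    by (intro exI[of _ N] exI[of _ K] exI[of _ e]) blast
qed

text \<open>If neither \<open>p\<close> nor \<open>y\<close> is isolated, choose \<open>b\<close> close to \<open>y\<close>: all maps with values \<open>y\<close> and \<open>b\<close>
  are uniformly close to the constant map \<open>y\<close>, which is too many for a \<open>\<sigma>\<close>-compact set.\<close>

lemma discrete_domain_or_range: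
  fixes y :: "'b::metric_space" and p :: "'a::t2_space"
  assumes X: "locally_compact_space (euclidean :: 'a topology)"
    and M: "locally_sigma_compact_space (MU_uc :: ('a \<Rightarrow> 'b set) topology)"
  shows "open {p} \<or> open {y}"
proof (rule ccontr)
  assume *: "\<not> (open {p} \<or> open {y})"
  obtain N :: "('a \<Rightarrow> 'b set) set" and K e where N: "sigma_compactin MU_uc N" and K: "compact K" "e > 0"
    "\<forall>G\<in>MU. (\<forall>x\<in>K. hausdorff_dist {y} (G x) < e) \<longrightarrow> G \<in> N"
    using sigma_compact_nbhd_of_const[OF M, of y] by meson
  have "ball y e \<noteq> {y}"
    using * by (metis open_ball)
  moreover have "y \<in> ball y e"
    using K(2) by simp
  ultimately obtain b where b: "b \<noteq> y" "dist y b < e"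
    by (metis mem_ball set_eq_iff singleton_iff)
  have "\<exists>V. open V \<and> (\<exists>L. compact L \<and> p \<in> V \<and> V \<subseteq> L)"
    using X unfolding locally_compact_space_def by simp
  then obtain V L where V: "open V" "p \<in> V" "V \<subseteq> L" and L: "compact L"
    by blast
  show False
  proof (rule two_valued_not_sigma_compact[OF V L _ b(1)[symmetric] N])
    fix U :: "'a set" assume "open U"
    show "two_valued y b U \<in> N"
    proof (rule K(3)[rule_format, OF two_valued_MU[OF \<open>open U\<close>]])
      fix x
      have "dist y c \<le> dist y b" if "c \<in> two_valued y b U x" for c
        using two_valued_subset[of y b U x] that by auto
      moreover obtain c where "c \<in> two_valued y b U x"
        using two_valued_nonempty[of y b U x] by blast
      ultimately have "hausdorff_dist {y} (two_valued y b U x) \<le> dist y b"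
        using MU_compact[OF two_valued_MU[OF \<open>open U\<close>], of y b x]
        by (subst hausdorff_dist_le_iff) (auto intro: bexI[of _ c])
      then show "hausdorff_dist {y} (two_valued y b U x) < e"
        using b(2) by linarith
    qed
  qed (use * in simp)
qed

text \<open>A non-isolated point outside \<open>K\<close> has a neighbourhood whose closure misses \<open>K\<close>. Maps that vary
  only in this neighbourhood equal \<open>a\<close> on \<open>K\<close>, hence lie in \<open>N\<close>, and there are too many of them. So the
  points outside \<open>K\<close> are isolated, and any compact neighbourhood of \<open>K\<close> is open.\<close>

lemma clopen_compact_with_discrete_complement:
  fixes K :: "'a::t2_space set" and a b :: "'b::metric_space"
  assumes X: "locally_compact_space (euclidean :: 'a topology)" and ab: "a \<noteq> b"
    and N: "sigma_compactin MU_uc N" and K: "compact K"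
    and sub: "\<And>G. G \<in> MU \<Longrightarrow> (\<And>x. x \<in> K \<Longrightarrow> G x = {a}) \<Longrightarrow> G \<in> N"
  shows "\<exists>K'. K \<subseteq> K' \<and> open K' \<and> compact K' \<and> (\<forall>x. x \<notin> K' \<longrightarrow> open {x})"
proof -
  have haus: "Hausdorff_space (euclidean :: 'a topology)"
    unfolding Hausdorff_space_def disjnt_def using hausdorff by auto
  have iso: "open {p}" if p: "p \<notin> K" for p
  proof (rule ccontr)
    assume np: "\<not> open {p}"
    have "compactin euclidean {p}" "compactin euclidean K" "disjnt {p} K"
      using K p by (auto simp: disjnt_def)
    then obtain A B where AB: "open A" "open B" "p \<in> A" "K \<subseteq> B" "A \<inter> B = {}"
      using Hausdorff_space_compact_separation[OF haus, of "{p}" K] by (auto simp: disjnt_def)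
    have "\<exists>V. open V \<and> (\<exists>L. compact L \<and> p \<in> V \<and> V \<subseteq> L)"
      using X unfolding locally_compact_space_def by simp
    then obtain V L where V: "open V" "p \<in> V" "V \<subseteq> L" and L: "compact L"
      by blast
    have "two_valued a b U \<in> N" if U: "open U" "U \<subseteq> A \<inter> V" for U
    proof (rule sub[OF two_valued_MU[OF U(1)]])
      fix x assume "x \<in> K"
      then have "x \<in> B" "B \<inter> U = {}"
        using AB U by auto
      then have "x \<notin> closure U"
        using open_Int_closure_eq_empty[OF AB(2)] by blast
      then show "two_valued a b U x = {a}"
        by (rule two_valued_off_closure)
    qed
    then show False
      using two_valued_not_sigma_compact[of "A \<inter> V" p L a b N] AB V L np ab N by blast
  qed
  obtain U L where UL: "open U" "compact L" "K \<subseteq> U" "U \<subseteq> L"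
    using X K unfolding locally_compact_space_compact_closed_compact[OF disjI1[OF haus]] by auto
  have "L = U \<union> (\<Union>x\<in>L - K. {x})"
    using UL by blast
  moreover have "open (U \<union> (\<Union>x\<in>L - K. {x}))"
    using UL(1) iso by blast
  ultimately have "open L" by simp
  then show ?thesis
    using UL iso by (intro exI[of _ L]) blast
qed

text \<open>The diagonal argument: for an enumeration of the compact pieces of \<open>N\<close> by natural numbers and
  a sequence \<open>d\<close> of distinct isolated points, a piece with number \<open>n\<close> omits some value at \<open>d n\<close> if \<open>Y\<close>
  is not compact. A map that equals \<open>a\<close> on \<open>K\<close> and takes all these omitted values lies in \<open>N\<close> but in no
  piece.\<close>

lemma compact_range:
  fixes K :: "'a::t2_space set" and a :: "'b::metric_space"
  assumes K: "open K" and iso: "\<And>x. x \<notin> K \<Longrightarrow> open {x}" and inf: "infinite (- K)"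
    and N: "sigma_compactin MU_uc N"
    and sub: "\<And>G. G \<in> MU \<Longrightarrow> (\<And>x. x \<in> K \<Longrightarrow> G x = {a}) \<Longrightarrow> G \<in> N"
  shows "compact (UNIV :: 'b set)"
proof (rule ccontr)
  assume nc: "\<not> compact (UNIV :: 'b set)"
  obtain \<C> where C: "countable \<C>" "\<And>C. C \<in> \<C> \<Longrightarrow> compactin MU_uc C" "N = \<Union>\<C>"
    using N unfolding sigma_compactin_def by blast
  obtain d :: "nat \<Rightarrow> 'a" where d: "inj d" "range d \<subseteq> - K"
    using infinite_countable_subset[OF inf] by blast
  have "\<exists>y. y \<notin> eval_at (d (to_nat_on \<C> C)) ` C" if "C \<in> \<C>" for C
  proof -
    have "compact (eval_at (d (to_nat_on \<C> C)) ` C)"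
      by (rule compact_eval_at[OF iso C(2)[OF that]]) (use d(2) in blast)
    then show ?thesis
      using nc by (metis UNIV_eq_I)
  qed
  then obtain y where y: "\<And>C. C \<in> \<C> \<Longrightarrow> y C \<notin> eval_at (d (to_nat_on \<C> C)) ` C"
    by metis
  define g where "g x = y (from_nat_into \<C> (inv d x))" for x
  define G where "G = glue K (\<lambda>_. {a}) g"
  have "G \<in> N"
    unfolding G_def by (intro sub glue_MU K iso const_MU) (simp_all add: glue_def)
  then obtain C where CC: "C \<in> \<C>" "G \<in> C"
    using C(3) by blast
  define n where "n = to_nat_on \<C> C"
  have "g (d n) = y C"
    unfolding g_def n_def using d(1) C(1) CC(1) by (simp add: inv_f_f)
  moreover have "d n \<notin> K" using d(2) by blast
  ultimately have "eval_at (d n) G = y C"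
    by (simp add: eval_at_def G_def glue_def)
  then show False
    using y[OF CC(1)] imageI[OF CC(2), of "eval_at (d n)"] by (simp add: n_def)
qed

theorem theorem3p13:
  assumes "locally_compact_space (euclidean :: 'a::t2_space topology)"
    and "\<exists>y y' :: 'b::metric_space. y \<noteq> y'"
  shows "locally_sigma_compact_space (MU_uc :: ('a \<Rightarrow> 'b set) topology) \<longleftrightarrow>
    locally_compact_space (MU_uc :: ('a \<Rightarrow> 'b set) topology) \<or>
    (locally_sigma_compact_space (euclidean :: 'b topology) \<and> finite (UNIV :: 'a set))"
proof
  assume "locally_compact_space (MU_uc :: ('a \<Rightarrow> 'b set) topology) \<or>
    (locally_sigma_compact_space (euclidean :: 'b topology) \<and> finite (UNIV :: 'a set))"
  then show "locally_sigma_compact_space (MU_uc :: ('a \<Rightarrow> 'b set) topology)"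
    using locally_compact_imp_locally_sigma_compact MU_locally_sigma_compact_finite_domain by blast
next
  assume M: "locally_sigma_compact_space (MU_uc :: ('a \<Rightarrow> 'b set) topology)"
  show "locally_compact_space (MU_uc :: ('a \<Rightarrow> 'b set) topology) \<or>
    (locally_sigma_compact_space (euclidean :: 'b topology) \<and> finite (UNIV :: 'a set))"
  proof (cases "finite (UNIV :: 'a set)")
    case True
    then show ?thesis
      using range_locally_sigma_compact[OF M finite_imp_isolated] by blast
  next
    case False
    obtain a b :: 'b where ab: "a \<noteq> b" using assms(2) by blast
    obtain N :: "('a \<Rightarrow> 'b set) set" and K e where N: "sigma_compactin MU_uc N" and K: "compact K" "e > 0"
      "\<forall>G\<in>MU. (\<forall>x\<in>K. hausdorff_dist {a} (G x) < e) \<longrightarrow> G \<in> N"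
      using sigma_compact_nbhd_of_const[OF M, of a] by meson
    have sub: "G \<in> N" if "G \<in> MU" "\<And>x. x \<in> K \<Longrightarrow> G x = {a}" for G
      using that K(2) by (intro K(3)[rule_format]) simp_all
    have "\<exists>K'. K \<subseteq> K' \<and> open K' \<and> compact K' \<and> (\<forall>x. x \<notin> K' \<longrightarrow> open {x})"
      using sub by (rule clopen_compact_with_discrete_complement[OF assms(1) ab N K(1)])
    then obtain K' where K': "K \<subseteq> K'" "open K'" "compact K'" "\<And>x. x \<notin> K' \<Longrightarrow> open {x}"
      by blast
    have comp: "compact (UNIV :: 'b set)" if "infinite (- K')"
      by (rule compact_range[OF K'(2,4) that N, of a]) (use sub K'(1) in blast)+
    have "locally_compact_space (MU_uc :: ('a \<Rightarrow> 'b set) topology)"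
    proof (cases "\<forall>y::'b. open {y}")
      case discY: True
      \<comment> \<open>if the discrete part is finite, then \<open>X\<close> is compact and takes the place of \<open>K'\<close>\<close>
      show ?thesis
      proof (cases "finite (- K')")
        case True
        have "compact (K' \<union> - K')"
          using K'(3) finite_imp_compact[OF True] by (rule compact_Un)
        then have "compact (UNIV :: 'a set)"
          by simp
        then show ?thesis
          using discY by (intro locally_compact_MU_uc[of UNIV]) simp_all
      next
        case False
        then show ?thesis
          using K' comp discY by (intro locally_compact_MU_uc[of K']) blast+
      qed
    next
      case False
      then have iso: "open {x}" for x :: 'a
        using discrete_domain_or_range[OF assms(1) M] by blast
      then have "finite K'"
        using compact_isolated_finite[OF K'(3)] by blast
      then have "infinite (- K')"
        using \<open>infinite (UNIV :: 'a set)\<close> by (metis Compl_partition finite_Un)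
      then show ?thesis
        using comp iso by (intro locally_compact_MU_uc[of "{}"]) simp_all
    qed
    then show ?thesis ..
  qed
qed

end
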